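(* The cardinality-testing subprotocol $\Pi_{\mathrm{CT}}^{\tau}$ described in the context outputs the correct value of $\mathsf{flag}$, i.e.: (a) for all inputs $z^{\mathsf S},z^{\mathsf O}\in\{0,1\}^M$ of TP and $\rho,m_{\mathcal U},m_{\mathcal A}\in\{0,1\}^M$ of the participant side, and all choices of the additive shares returned by the oblivious-inner-product calls, the output satisfies $$\mathsf{flag}=1\iff (d_{\mathcal A}=0)\ \wedge\ (d_{\mathcal U}\le|\mathcal U|-\tau),$$ where for $R\in\{\mathcal U,\mathcal A\}$ the integer $d_R$ is $d_R=|R|-\sum_{t=0}^{M-1}m_{R,t}\bigl((1-\rho_t)z_t^{\mathsf S}+\rho_tz_t^{\mathsf O}\bigr)$; (b) consequently, when $z^{\mathsf S},z^{\mathsf O}$ are the correct label vectors of an honest quantum phase (as defined in the context), $\mathsf{flag}=1$ if and only if $\bigl|\bigcap_{i=1}^nX_i\bigr|\ge\tau$.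
   Context: Sets. Let $n\ge1$. The augmented universe $\{0,\dots,M-1\}$ is the disjoint union of the real domain $\mathcal U=\{0,\dots,q-1\}$ and two anchor sets $\mathcal A^+,\mathcal A^-$; put $\mathcal A=\mathcal A^+\cup\mathcal A^-$. Participant $P_i$ ($1\le i\le n$) holds $X_i\subseteq\mathcal U$, and $\widetilde X_i=X_i\cup\mathcal A^+$. The threshold $\tau$ is a nonnegative integer. Let $k\in\mathbb Z_M^*$, $\mathbf b\in\{0,1\}^M$, and for a set $S$ write $kS=\{kx\bmod M:x\in S\}$. The participant side holds the selector vectors $m_{\mathcal U}=\mathbf 1_{k\mathcal U}$, $m_{\mathcal A}=\mathbf 1_{k\mathcal A^+\cup k\mathcal A^-}$ (indicator vectors in $\{0,1\}^M$), and the reference label vector $\rho\in\{0,1\}^M$, $\rho_t=1\oplus b_t$ for $t\in k\mathcal U\cup k\mathcal A^+$ and $\rho_t=b_t$ for $t\in k\mathcal A^-$. In part (a), $\rho$ may be any vector in $\{0,1\}^M$, and $m_{\mathcal U},m_{\mathcal A}$ are selectors of $|\mathcal U|$, respectively $|\mathcal A|$, positions (i.e. $m_R$ has exactly $|R|$ ones). Correct label vectors. Let $Y_i=\mathbf 1_{k\widetilde X_i}$ and $r_t=\sum_{i=1}^nY_{i,t}$. The label vectors $z^{\mathsf S},z^{\mathsf O}\in\{0,1\}^M$ are the correct ones of an honest quantum phase if for every $t$: when $r_t=0$, $(z_t^{\mathsf S},z_t^{\mathsf O})=(1\oplus b_t,\,b_t)$; when $1\le r_t\le n-1$, $(z_t^{\mathsf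 S},z_t^{\mathsf O})=(0,0)$; when $r_t=n$, $(z_t^{\mathsf S},z_t^{\mathsf O})=(b_t,\,1\oplus b_t)$. Subprotocol $\Pi_{\mathrm{CT}}^{\tau}$. Let $p>2M$ be a prime; $\odot$ is the coordinatewise product and $\langle\cdot,\cdot\rangle$ the standard inner product. An oblivious-inner-product (OIP) call on vectors $\mathbf a$ (from TP) and $\mathbf c$ (from the participant side) returns additive shares, one to each side, whose sum is $\langle\mathbf a,\mathbf c\rangle$ modulo $p$. For $R\in\{\mathcal U,\mathcal A\}$, OIP calls give shares with $a_R^{\mathrm{TP}}+a_R^{\mathrm P}=\langle z^{\mathsf S},m_R\odot(1-\rho)\rangle$ and $c_R^{\mathrm{TP}}+c_R^{\mathrm P}=\langle z^{\mathsf O},m_R\odot\rho\rangle$ modulo $p$. TP computes $\delta_R^{\mathrm{TP}}=-a_R^{\mathrm{TP}}-c_R^{\mathrm{TP}}\bmod p$ and the participant side computes $\delta_R^{\mathrm P}=|R|-a_R^{\mathrm P}-c_R^{\mathrm P}\bmod p$. A (correctly evaluated) garbled circuit takes these values, forms the integers $\hat d_R=(\delta_R^{\mathrm{TP}}+\delta_R^{\mathrm P})\bmod p\in\{0,\dots,p-1\}$ for $R\in\{\mathcal U,\mathcal A\}$, and outputs $\mathsf{flag}=1$ if $\hat d_{\mathcal A}=0$ and $\hat d_{\mathcal U}\le|\mathcal U|-\tau$ (comparison of integers), and $\mathsf{flag}=0$ otherwise. *)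

theory Defs
  imports "HOL-Number_Theory.Cong" "Jordan_Normal_Form.Matrix"
begin

section \<open>Augmented universe and multiplicative re-indexing\<close>

definition augmented_universe :: "nat \<Rightarrow> nat \<Rightarrow> nat set \<Rightarrow> nat set \<Rightarrow> bool" where
  "augmented_universe M q Apos Aneg \<longleftrightarrow>
     {0..<q} \<union> Apos \<union> Aneg = {0..<M} \<and>
     {0..<q} \<inter> Apos = {} \<and> {0..<q} \<inter> Aneg = {} \<and> Apos \<inter> Aneg = {}"

definition scaled_set :: "nat \<Rightarrow> nat \<Rightarrow> nat set \<Rightarrow> nat set" where
  "scaled_set M k S = (\<lambda>x. (k * x) mod M) ` S"

text \<open>Representatives of the units modulo \<open>M\<close> are taken in \<open>{0..<M}\<close>; in particular, the
  only unit modulo 1 is 0, and there is none for \<open>M = 0\<close>.\<close>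

definition unit_residues :: "nat \<Rightarrow> nat set" where
  "unit_residues M = {k. k < M \<and> coprime k M}"


section \<open>Bit vectors\<close>

text \<open>Bits are the integers 0 and 1, so that sums and inner products of bit vectors are integers
  and \<open>xor\<close> is the library's bitwise operation on \<^typ>\<open>int\<close>.\<close>

definition bitvecs :: "nat \<Rightarrow> int vec set" where
  "bitvecs M = {v \<in> carrier_vec M. \<forall>t<M. v $ t \<in> {0, 1}}"

definition indicator_vec :: "nat \<Rightarrow> nat set \<Rightarrow> int vec" where
  "indicator_vec M S = vec M (\<lambda>t. if t \<in> S then 1 else 0)"

definition selects :: "nat \<Rightarrow> int vec \<Rightarrow> nat \<Rightarrow> bool" where
  "selects M m s \<longleftrightarrow> m \<in> bitvecs M \<and> card {t. t < M \<and> m $ t = 1} = s"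

definition hadamard :: "int vec \<Rightarrow> int vec \<Rightarrow> int vec" where
  "hadamard u v = vec (dim_vec u) (\<lambda>t. u $ t * v $ t)"

definition ones_vec :: "nat \<Rightarrow> int vec" where
  "ones_vec M = vec M (\<lambda>_. 1)"


section \<open>The two regions, selectors and reference labels\<close>

text \<open>The index \<open>R\<close> of the protocol ranges over the real domain and the set of all anchors.
  A separate index type keeps the two regions apart even when both sets are empty.\<close>

datatype region = Real_Domain | Anchors

fun region_set :: "nat \<Rightarrow> nat set \<Rightarrow> nat set \<Rightarrow> region \<Rightarrow> nat set" where
  "region_set q Apos Aneg Real_Domain = {0..<q}"
| "region_set q Apos Aneg Anchors = Apos \<union> Aneg"

definition region_size :: "nat \<Rightarrow> nat set \<Rightarrow> nat set \<Rightarrow> region \<Rightarrow> nat" where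
  "region_size q Apos Aneg R = card (region_set q Apos Aneg R)"

fun selector :: "nat \<Rightarrow> nat \<Rightarrow> nat \<Rightarrow> nat set \<Rightarrow> nat set \<Rightarrow> region \<Rightarrow> int vec" where
  "selector M k q Apos Aneg Real_Domain = indicator_vec M (scaled_set M k {0..<q})"
| "selector M k q Apos Aneg Anchors =
     indicator_vec M (scaled_set M k Apos \<union> scaled_set M k Aneg)"

definition reference_labels ::
  "nat \<Rightarrow> nat \<Rightarrow> nat \<Rightarrow> nat set \<Rightarrow> nat set \<Rightarrow> int vec \<Rightarrow> int vec \<Rightarrow> bool" where
  "reference_labels M k q Apos Aneg b \<rho> \<longleftrightarrow>
     \<rho> \<in> bitvecs M \<and>
     (\<forall>t \<in> scaled_set M k {0..<q} \<union> scaled_set M k Apos. \<rho> $ t = xor 1 (b $ t)) \<and>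
     (\<forall>t \<in> scaled_set M k Aneg. \<rho> $ t = b $ t)"


section \<open>Correct label vectors of an honest quantum phase\<close>

definition marker_count ::
  "nat \<Rightarrow> nat \<Rightarrow> nat set \<Rightarrow> nat \<Rightarrow> (nat \<Rightarrow> nat set) \<Rightarrow> nat \<Rightarrow> int" where
  "marker_count M k Apos n X t =
     (\<Sum>i = 1..n. indicator_vec M (scaled_set M k (X i \<union> Apos)) $ t)"

definition correct_labels ::
  "nat \<Rightarrow> nat \<Rightarrow> nat set \<Rightarrow> nat \<Rightarrow> (nat \<Rightarrow> nat set) \<Rightarrow> int vec \<Rightarrow> int vec \<Rightarrow> int vec \<Rightarrow> bool" where
  "correct_labels M k Apos n X b zS zO \<longleftrightarrow>
     zS \<in> bitvecs M \<and> zO \<in> bitvecs M \<and>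
     (\<forall>t<M. let r = marker_count M k Apos n X t in
        (r = 0 \<longrightarrow> zS $ t = xor 1 (b $ t) \<and> zO $ t = b $ t) \<and>
        (1 \<le> r \<and> r \<le> int n - 1 \<longrightarrow> zS $ t = 0 \<and> zO $ t = 0) \<and>
        (r = int n \<longrightarrow> zS $ t = b $ t \<and> zO $ t = xor 1 (b $ t)))"


section \<open>The cardinality-testing subprotocol\<close>

text \<open>Residues modulo \<open>p\<close> are represented by integers in \<open>{0..<p}\<close>.\<close>

definition oip_shares :: "int \<Rightarrow> int vec \<Rightarrow> int vec \<Rightarrow> int \<Rightarrow> int \<Rightarrow> bool" where
  "oip_shares p a c sTP sP \<longleftrightarrow>
     sTP \<in> {0..<p} \<and> sP \<in> {0..<p} \<and> [sTP + sP = a \<bullet> c] (mod p)"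

definition ct_shares ::
  "int \<Rightarrow> nat \<Rightarrow> int vec \<Rightarrow> int vec \<Rightarrow> int vec \<Rightarrow> (region \<Rightarrow> int vec) \<Rightarrow>
   (region \<Rightarrow> int) \<Rightarrow> (region \<Rightarrow> int) \<Rightarrow> (region \<Rightarrow> int) \<Rightarrow> (region \<Rightarrow> int) \<Rightarrow> bool" where
  "ct_shares p M zS zO \<rho> m aTP aP cTP cP \<longleftrightarrow>
     (\<forall>R. oip_shares p zS (hadamard (m R) (ones_vec M - \<rho>)) (aTP R) (aP R) \<and>
          oip_shares p zO (hadamard (m R) \<rho>) (cTP R) (cP R))"

definition tp_delta :: "int \<Rightarrow> (region \<Rightarrow> int) \<Rightarrow> (region \<Rightarrow> int) \<Rightarrow> region \<Rightarrow> int" where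
  "tp_delta p aTP cTP R = (- aTP R - cTP R) mod p"

definition participant_delta ::
  "int \<Rightarrow> (region \<Rightarrow> nat) \<Rightarrow> (region \<Rightarrow> int) \<Rightarrow> (region \<Rightarrow> int) \<Rightarrow> region \<Rightarrow> int" where
  "participant_delta p sz aP cP R = (int (sz R) - aP R - cP R) mod p"

text \<open>The comparison is one of integers: its right-hand side is negative when the threshold
  exceeds the size of the real domain.\<close>

definition garbled_flag ::
  "int \<Rightarrow> nat \<Rightarrow> (region \<Rightarrow> nat) \<Rightarrow> (region \<Rightarrow> int) \<Rightarrow> (region \<Rightarrow> int) \<Rightarrow> nat" where
  "garbled_flag p \<tau> sz \<delta>TP \<delta>P =
     (let dhat = (\<lambda>R. (\<delta>TP R + \<delta>P R) mod p)
      in if dhat Anchors = 0 \<and> dhat Real_Domain \<le> int (sz Real_Domain) - int \<tau> then 1 else 0)"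

definition ct_flag ::
  "int \<Rightarrow> nat \<Rightarrow> (region \<Rightarrow> nat) \<Rightarrow>
   (region \<Rightarrow> int) \<Rightarrow> (region \<Rightarrow> int) \<Rightarrow> (region \<Rightarrow> int) \<Rightarrow> (region \<Rightarrow> int) \<Rightarrow> nat" where
  "ct_flag p \<tau> sz aTP aP cTP cP =
     garbled_flag p \<tau> sz (tp_delta p aTP cTP) (participant_delta p sz aP cP)"

definition deficit :: "nat \<Rightarrow> nat \<Rightarrow> int vec \<Rightarrow> int vec \<Rightarrow> int vec \<Rightarrow> int vec \<Rightarrow> int" where
  "deficit M s m \<rho> zS zO =
     int s - (\<Sum>t = 0..<M. m $ t * ((1 - \<rho> $ t) * zS $ t + \<rho> $ t * zO $ t))"

end

theory Submission imports Defs begin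

text \<open>The shares cancel in \<open>\<delta>\<^sub>R\<^sup>T\<^sup>P + \<delta>\<^sub>R\<^sup>P\<close>, which is therefore congruent to the deficit \<open>d\<^sub>R\<close>
  modulo \<open>p\<close>; since \<open>0 \<le> d\<^sub>R \<le> M < p\<close>, the circuit recovers \<open>d\<^sub>R\<close> as an integer. In the honest case,
  multiplication by the unit \<open>k\<close> permutes the residues, so \<open>d\<^sub>R\<close> counts the elements \<open>x\<close> of the region
  whose labels at position \<open>k x\<close> do not match the reference. All anchors match, and an element of the
  real domain matches exactly when all participants hold it.\<close>

section \<open>Matching labels and bounds on the deficit\<close>

text \<open>A multiplexer: the bit \<open>\<rho> $ t\<close> decides which of the two labels is read
  at \<open>t\<close>, \<open>zS\<close> for 0 and \<open>zO\<close> for 1. Value 1 is a match with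
  the reference.\<close>

definition label_match :: "int vec \<Rightarrow> int vec \<Rightarrow> int vec \<Rightarrow> nat \<Rightarrow> int" where
  "label_match \<rho> zS zO t = (1 - \<rho> $ t) * zS $ t + \<rho> $ t * zO $ t"

lemma deficit_label_match:
  "deficit M s m \<rho> zS zO = int s - (\<Sum>t = 0..<M. m $ t * label_match \<rho> zS zO t)"
  by (simp add: deficit_def label_match_def)

lemma bitvecs_dim: "v \<in> bitvecs M \<Longrightarrow> dim_vec v = M"
  by (auto simp: bitvecs_def)

lemma bitvecs_cases:
  assumes "v \<in> bitvecs M" "t < M"
  obtains "v $ t = 0" | "v $ t = 1"
  using assms by (auto simp: bitvecs_def)

lemma label_match_bit:
  assumes "\<rho> \<in> bitvecs M" "zS \<in> bitvecs M" "zO \<in> bitvecs M" "t < M"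
  shows "label_match \<rho> zS zO t \<in> {0, 1}"
  by (rule bitvecs_cases[OF assms(1,4)]; rule bitvecs_cases[OF assms(2,4)];
      rule bitvecs_cases[OF assms(3,4)]) (simp_all add: label_match_def)

lemma selects_sum:
  assumes "selects M m s"
  shows "(\<Sum>t = 0..<M. m $ t) = int s"
proof -
  have "(\<Sum>t = 0..<M. m $ t) = (\<Sum>t = 0..<M. if m $ t = 1 then 1 else 0)"
    using assms by (intro sum.cong) (auto simp: selects_def bitvecs_def)
  also have "\<dots> = int (card {t \<in> {0..<M}. m $ t = 1})"
    by (subst sum.inter_filter [symmetric]) simp_all
  also have "{t \<in> {0..<M}. m $ t = 1} = {t. t < M \<and> m $ t = 1}"
    by auto
  finally show ?thesis
    using assms by (simp add: selects_def)
qed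

text \<open>Each selected position contributes a bit, so the sum lies between 0 and the number
  \<open>s\<close> of selected positions. These bounds later allow the integer to be recovered from
  its residue.\<close>

lemma deficit_bounds:
  assumes "selects M m s" "\<rho> \<in> bitvecs M" "zS \<in> bitvecs M" "zO \<in> bitvecs M"
  shows "0 \<le> deficit M s m \<rho> zS zO" "deficit M s m \<rho> zS zO \<le> int s"
proof -
  have m: "m $ t \<in> {0, 1}" if "t < M" for t
    using assms(1) that by (auto simp: selects_def bitvecs_def)
  have lm: "label_match \<rho> zS zO t \<in> {0, 1}" if "t < M" for t
    using label_match_bit assms that by blast
  have "(\<Sum>t = 0..<M. m $ t * label_match \<rho> zS zO t) \<le> (\<Sum>t = 0..<M. m $ t)"
    using m lm by (intro sum_mono) fastforce
  then show "0 \<le> deficit M s m \<rho> zS zO"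
    using selects_sum[OF assms(1)] by (simp add: deficit_label_match)
  have "0 \<le> (\<Sum>t = 0..<M. m $ t * label_match \<rho> zS zO t)"
    using m lm by (intro sum_nonneg) fastforce
  then show "deficit M s m \<rho> zS zO \<le> int s"
    by (simp add: deficit_label_match)
qed

section \<open>From shares to the flag\<close>

lemma deficit_inner_products:
  assumes "\<rho> \<in> bitvecs M" "m \<in> bitvecs M"
  shows "int s - zS \<bullet> hadamard m (ones_vec M - \<rho>) - zO \<bullet> hadamard m \<rho> = deficit M s m \<rho> zS zO"
  \<comment> \<open>The sum in \<open>scalar_prod\<close> ranges over the dimension of its second
    argument, which \<open>hadamard\<close> takes from \<open>m\<close>; the dimension of
    \<open>\<rho>\<close> lets \<open>ones_vec M - \<rho>\<close> be evaluated entrywise.\<close>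
  using bitvecs_dim[OF assms(1)] bitvecs_dim[OF assms(2)]
  by (simp add: deficit_def scalar_prod_def hadamard_def ones_vec_def algebra_simps
      flip: sum.distrib)

lemma delta_sum_eq_deficit:
  assumes "selects M (m R) (sz R)" "\<rho> \<in> bitvecs M" "zS \<in> bitvecs M" "zO \<in> bitvecs M"
    and sh: "ct_shares p M zS zO \<rho> m aTP aP cTP cP"
    and p: "int (sz R) < p"
  shows "(tp_delta p aTP cTP R + participant_delta p sz aP cP R) mod p
    = deficit M (sz R) (m R) \<rho> zS zO"
proof -
  let ?a = "zS \<bullet> hadamard (m R) (ones_vec M - \<rho>)" and ?c = "zO \<bullet> hadamard (m R) \<rho>"
  have cong: "[aTP R + aP R = ?a] (mod p)" "[cTP R + cP R = ?c] (mod p)"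
    using sh by (auto simp: ct_shares_def oip_shares_def)
  have "(tp_delta p aTP cTP R + participant_delta p sz aP cP R) mod p
      = (int (sz R) - (aTP R + aP R) - (cTP R + cP R)) mod p"
    by (simp add: tp_delta_def participant_delta_def mod_add_eq algebra_simps)
  also have "\<dots> = (int (sz R) - ?a - ?c) mod p"
    using cong_diff[OF cong_diff[OF cong_refl cong(1)] cong(2)] by (simp add: cong_def)
  also have "int (sz R) - ?a - ?c = deficit M (sz R) (m R) \<rho> zS zO"
    using assms(1,2) by (intro deficit_inner_products) (auto simp: selects_def)
  \<comment> \<open>The deficit lies between 0 and \<open>sz R < p\<close>, so reduction leaves it
    unchanged; a congruence alone would not determine the integer that the circuit compares.\<close>
  also have "\<dots> mod p = \<dots>"
    using deficit_bounds[OF assms(1-4)] p by (intro mod_pos_pos_trivial) auto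
  finally show ?thesis .
qed

text \<open>Kept general in \<open>m\<close> and \<open>sz\<close>, so that it serves both arbitrary
  selectors and those built from \<open>k\<close>.\<close>

lemma ct_flag_iff_deficit:
  assumes "\<And>R. selects M (m R) (sz R)" "\<rho> \<in> bitvecs M" "zS \<in> bitvecs M" "zO \<in> bitvecs M"
    and "ct_shares p M zS zO \<rho> m aTP aP cTP cP"
    and "\<And>R. int (sz R) < p"
  shows "ct_flag p \<tau> sz aTP aP cTP cP = 1 \<longleftrightarrow>
    deficit M (sz Anchors) (m Anchors) \<rho> zS zO = 0 \<and>
    deficit M (sz Real_Domain) (m Real_Domain) \<rho> zS zO \<le> int (sz Real_Domain) - int \<tau>"
  using delta_sum_eq_deficit[where sz = sz and m = m and R = Anchors, OF assms]
    delta_sum_eq_deficit[where sz = sz and m = m and R = Real_Domain, OF assms]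
  by (simp add: ct_flag_def garbled_flag_def Let_def)

section \<open>Multiplication by a unit modulo \<open>M\<close>\<close>

lemma inj_on_scale:
  assumes "coprime k (M::nat)"
  shows "inj_on (\<lambda>x. (k * x) mod M) {0..<M}"
proof (rule inj_onI)
  fix x y
  assume xy: "x \<in> {0..<M}" "y \<in> {0..<M}" and "(k * x) mod M = (k * y) mod M"
  then have "[k * x = k * y] (mod M)"
    by (simp add: cong_def)
  then have "[x = y] (mod M)"
    using assms by (simp add: cong_mult_lcancel_nat)
  then show "x = y"
    using xy by (simp add: cong_def)
qed

text \<open>By injectivity on residues, no other element of \<open>S\<close> can land on the
  position of \<open>x\<close>. This lets the marker count at \<open>k x\<close> be read off from
  the sets containing \<open>x\<close>.\<close>

lemma scaled_mem_iff:
  assumes "coprime k M" "S \<subseteq> {0..<M}" "x < M"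
  shows "(k * x) mod M \<in> scaled_set M k S \<longleftrightarrow> x \<in> S"
  unfolding scaled_set_def
  using inj_on_image_mem_iff[OF inj_on_scale[OF assms(1)], of x S] assms(2,3) by simp

text \<open>Positivity matters because reduction modulo 0 is the identity on
  \<open>nat\<close>.\<close>

lemma scaled_set_subset: "M > 0 \<Longrightarrow> scaled_set M k S \<subseteq> {0..<M}"
  by (auto simp: scaled_set_def)

lemma card_scaled_set:
  assumes "coprime k M" "S \<subseteq> {0..<M}"
  shows "card (scaled_set M k S) = card S"
  unfolding scaled_set_def
  using inj_on_subset[OF inj_on_scale[OF assms(1)] assms(2)] by (rule card_image)

lemma selects_indicator:
  assumes "S \<subseteq> {0..<M}"
  shows "selects M (indicator_vec M S) (card S)"
proof -
  have "{t. t < M \<and> indicator_vec M S $ t = 1} = S"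
    using assms by (auto simp: indicator_vec_def split: if_splits)
  then show ?thesis
    by (simp add: selects_def bitvecs_def indicator_vec_def)
qed

text \<open>Reindexing along \<open>x\<close> to \<open>k x\<close>, which is injective on
  \<open>S\<close>, moves the count from vector positions to elements of the universe.\<close>

lemma deficit_indicator_scaled:
  assumes "coprime k M" "S \<subseteq> {0..<M}" "M > 0"
  shows "deficit M (card S) (indicator_vec M (scaled_set M k S)) \<rho> zS zO
    = int (card S) - (\<Sum>x\<in>S. label_match \<rho> zS zO ((k * x) mod M))"
proof -
  let ?f = "label_match \<rho> zS zO"
  have "(\<Sum>t = 0..<M. indicator_vec M (scaled_set M k S) $ t * ?f t)
      = (\<Sum>t = 0..<M. if t \<in> scaled_set M k S then ?f t else 0)"
    by (intro sum.cong) (auto simp: indicator_vec_def)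
  also have "\<dots> = (\<Sum>t\<in>scaled_set M k S. ?f t)"
    using scaled_set_subset[OF assms(3)]
    by (subst sum.inter_restrict [symmetric]) (auto intro!: sum.cong)
  also have "\<dots> = (\<Sum>x\<in>S. ?f ((k * x) mod M))"
    unfolding scaled_set_def
    using inj_on_subset[OF inj_on_scale[OF assms(1)] assms(2)] by (simp add: sum.reindex)
  finally show ?thesis
    by (simp add: deficit_label_match)
qed

section \<open>Regions, marker counts and honest labels\<close>

lemma selector_eq:
  "selector M k q Apos Aneg R = indicator_vec M (scaled_set M k (region_set q Apos Aneg R))"
  by (cases R) (auto simp: scaled_set_def image_Un)

lemma region_set_subset:
  assumes "augmented_universe M q Apos Aneg"
  shows "region_set q Apos Aneg R \<subseteq> {0..<M}"
  using assms by (cases R) (auto simp: augmented_universe_def)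

lemma region_size_le:
  assumes "augmented_universe M q Apos Aneg"
  shows "region_size q Apos Aneg R \<le> M"
  using card_mono[OF _ region_set_subset[OF assms]] by (simp add: region_size_def)

lemma marker_count_scaled:
  assumes "coprime k M" "x < M" "\<And>i. i \<in> {1..n} \<Longrightarrow> X i \<union> Apos \<subseteq> {0..<M}"
  shows "marker_count M k Apos n X ((k * x) mod M) = int (card {i \<in> {1..n}. x \<in> X i \<union> Apos})"
proof -
  have "marker_count M k Apos n X ((k * x) mod M) = (\<Sum>i = 1..n. if x \<in> X i \<union> Apos then 1 else 0)"
    unfolding marker_count_def
  proof (rule sum.cong)
    fix i assume "i \<in> {1..n}"
    then show "indicator_vec M (scaled_set M k (X i \<union> Apos)) $ ((k * x) mod M)
        = (if x \<in> X i \<union> Apos then 1 else 0)"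
      using scaled_mem_iff[OF assms(1) assms(3) assms(2)] assms(2) by (simp add: indicator_vec_def)
  qed simp
  also have "\<dots> = int (card {i \<in> {1..n}. x \<in> X i \<union> Apos})"
    by (subst sum.inter_filter [symmetric]) simp_all
  finally show ?thesis .
qed

text \<open>At count 0 the label pair is (1 - b, b), and the label read is 1 exactly when
  \<open>\<rho>\<close> agrees with \<open>b\<close>; at count \<open>n\<close> the pair is swapped,
  and it is 1 exactly when \<open>\<rho>\<close> differs from \<open>b\<close>. The reference thus
  tests for a full count on the real domain and \<open>Apos\<close>, and for an empty count on
  \<open>Aneg\<close>.\<close>

lemma honest_label_match:
  assumes n: "n \<ge> 1" and univ: "augmented_universe M q Apos Aneg" and k: "coprime k M"
    and b: "b \<in> bitvecs M" and X: "\<And>i. i \<in> {1..n} \<Longrightarrow> X i \<subseteq> {0..<q}"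
    and ref: "reference_labels M k q Apos Aneg b \<rho>"
    and cor: "correct_labels M k Apos n X b zS zO"
    and x: "x < M"
  shows "label_match \<rho> zS zO ((k * x) mod M)
    = (if x \<in> Apos \<union> Aneg \<union> (\<Inter>i\<in>{1..n}. X i) then 1 else 0)"
proof -
  let ?t = "(k * x) mod M" and ?I = "{i \<in> {1..n}. x \<in> X i \<union> Apos}"
  have t: "?t < M"
    using x by simp
  have U: "{0..<q} \<union> Apos \<union> Aneg = {0..<M}" and disj: "{0..<q} \<inter> Apos = {}"
    "{0..<q} \<inter> Aneg = {}" "Apos \<inter> Aneg = {}"
    using univ by (auto simp: augmented_universe_def)
  have r: "marker_count M k Apos n X ?t = int (card ?I)"
  proof (rule marker_count_scaled[OF k x])
    fix i assume "i \<in> {1..n}"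
    then show "X i \<union> Apos \<subseteq> {0..<M}"
      using X U by blast
  qed
  have none: "zS $ ?t = xor 1 (b $ ?t)" "zO $ ?t = b $ ?t" if "card ?I = 0"
    using cor t r that unfolding correct_labels_def Let_def by auto
  have some: "zS $ ?t = 0" "zO $ ?t = 0" if "1 \<le> card ?I" "card ?I < n"
    using cor t r that unfolding correct_labels_def Let_def by auto
  have all: "zS $ ?t = b $ ?t" "zO $ ?t = xor 1 (b $ ?t)" if "card ?I = n"
    using cor t r that unfolding correct_labels_def Let_def by auto
  consider "x \<in> {0..<q}" | "x \<in> Apos" | "x \<in> Aneg"
    using U x by (metis UnE atLeastLessThan_iff le0)
  then show ?thesis
  proof cases
    case 1
    then have xA: "x \<notin> Apos" "x \<notin> Aneg"
      using disj by auto
    have \<rho>: "\<rho> $ ?t = xor 1 (b $ ?t)"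
      using ref 1 by (auto simp: reference_labels_def scaled_set_def)
    have le: "card ?I \<le> n"
      using card_mono[of "{1..n}" ?I] by fastforce
    \<comment> \<open>Outside \<open>Apos\<close>, a participant is counted only for holding
      \<open>x\<close> itself.\<close>
    have eq: "card ?I = n \<longleftrightarrow> x \<in> (\<Inter>i\<in>{1..n}. X i)"
    proof
      assume "card ?I = n"
      then have "?I = {1..n}"
        by (intro card_subset_eq) auto
      then show "x \<in> (\<Inter>i\<in>{1..n}. X i)"
        using xA by blast
    next
      assume "x \<in> (\<Inter>i\<in>{1..n}. X i)"
      then have "?I = {1..n}"
        by blast
      then show "card ?I = n"
        by simp
    qed
    consider "card ?I = 0" | "1 \<le> card ?I" "card ?I < n" | "card ?I = n"
      using le by linarith
    then show ?thesis
    proof cases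
      case 1
      \<comment> \<open>Since \<open>n \<ge> 1\<close>, a count of 0 is not a full count.\<close>
      then have "x \<notin> (\<Inter>i\<in>{1..n}. X i)"
        using eq 1 n by linarith
      moreover have "label_match \<rho> zS zO ?t = 0"
        using none[OF 1] \<rho> b t by (auto simp: label_match_def elim: bitvecs_cases)
      ultimately show ?thesis
        using xA by simp
    next
      case 2
      then have "x \<notin> (\<Inter>i\<in>{1..n}. X i)"
        using eq by linarith
      moreover have "label_match \<rho> zS zO ?t = 0"
        using some[OF 2] by (simp add: label_match_def)
      ultimately show ?thesis
        using xA by simp
    next
      case 3
      then have "x \<in> (\<Inter>i\<in>{1..n}. X i)"
        using eq by blast
      moreover have "label_match \<rho> zS zO ?t = 1"
        using all[OF 3] \<rho> b t by (auto simp: label_match_def elim: bitvecs_cases)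
      ultimately show ?thesis
        by simp
    qed
  next
    case 2
    have \<rho>: "\<rho> $ ?t = xor 1 (b $ ?t)"
      using ref 2 by (auto simp: reference_labels_def scaled_set_def)
    have "?I = {1..n}"
      using 2 by auto
    then have "card ?I = n"
      by simp
    then have "label_match \<rho> zS zO ?t = 1"
      using all \<rho> b t by (auto simp: label_match_def elim: bitvecs_cases)
    then show ?thesis
      using 2 by simp
  next
    case 3
    have \<rho>: "\<rho> $ ?t = b $ ?t"
      using ref 3 by (auto simp: reference_labels_def scaled_set_def)
    \<comment> \<open>Negative anchors are never added to a participant's set, and each
      \<open>X i\<close> stays in the real domain.\<close>
    have "?I = {}"
      using 3 disj X by blast
    then have "card ?I = 0"
      by simp
    then have "label_match \<rho> zS zO ?t = 1"
      using none \<rho> b t by (auto simp: label_match_def elim: bitvecs_cases)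
    then show ?thesis
      using 3 by simp
  qed
qed

text \<open>Summing the match bits over a region counts its matching elements; uniformity in
  \<open>R\<close> gives both tests as instances.\<close>

lemma honest_deficit:
  assumes n: "n \<ge> 1" and univ: "augmented_universe M q Apos Aneg" and k: "k \<in> unit_residues M"
    and b: "b \<in> bitvecs M" and X: "\<And>i. i \<in> {1..n} \<Longrightarrow> X i \<subseteq> {0..<q}"
    and ref: "reference_labels M k q Apos Aneg b \<rho>"
    and cor: "correct_labels M k Apos n X b zS zO"
  shows "deficit M (region_size q Apos Aneg R) (selector M k q Apos Aneg R) \<rho> zS zO
    = int (region_size q Apos Aneg R)
      - int (card (region_set q Apos Aneg R \<inter> (Apos \<union> Aneg \<union> (\<Inter>i\<in>{1..n}. X i))))"
proof -
  let ?S = "region_set q Apos Aneg R" and ?G = "Apos \<union> Aneg \<union> (\<Inter>i\<in>{1..n}. X i)"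
  \<comment> \<open>\<open>M > 0\<close> comes from \<open>k < M\<close> in
    \<open>unit_residues\<close>.\<close>
  have k': "coprime k M" and M: "M > 0"
    using k by (auto simp: unit_residues_def)
  have S: "?S \<subseteq> {0..<M}"
    by (rule region_set_subset[OF univ])
  then have fin: "finite ?S"
    using finite_subset by blast
  have "(\<Sum>x\<in>?S. label_match \<rho> zS zO ((k * x) mod M)) = (\<Sum>x\<in>?S. if x \<in> ?G then 1 else 0)"
  proof (rule sum.cong)
    fix x assume "x \<in> ?S"
    then have "x < M"
      using S by auto
    then show "label_match \<rho> zS zO ((k * x) mod M) = (if x \<in> ?G then 1 else 0)"
      by (intro honest_label_match[OF n univ k' b _ ref cor]) (use X in auto)
  qed simp
  also have "\<dots> = int (card (?S \<inter> ?G))"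
    using fin by (subst sum.inter_restrict [symmetric]) simp_all
  finally show ?thesis
    using deficit_indicator_scaled[OF k' S M] by (simp add: selector_eq region_size_def)
qed

section \<open>Correctness of the flag\<close>

theorem theorem2:
  fixes n M q \<tau> :: nat and p :: int and Apos Aneg :: "nat set"
  assumes "n \<ge> 1"
    and "augmented_universe M q Apos Aneg"
    and "prime p" and "p > 2 * int M"
  shows
    "(\<forall>zS zO \<rho> m aTP aP cTP cP.
        zS \<in> bitvecs M \<longrightarrow> zO \<in> bitvecs M \<longrightarrow> \<rho> \<in> bitvecs M \<longrightarrow>
        (\<forall>R. selects M (m R) (region_size q Apos Aneg R)) \<longrightarrow>
        ct_shares p M zS zO \<rho> m aTP aP cTP cP \<longrightarrow>
        (ct_flag p \<tau> (region_size q Apos Aneg) aTP aP cTP cP = 1 \<longleftrightarrow>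
           deficit M (region_size q Apos Aneg Anchors) (m Anchors) \<rho> zS zO = 0 \<and>
           deficit M (region_size q Apos Aneg Real_Domain) (m Real_Domain) \<rho> zS zO
             \<le> int (region_size q Apos Aneg Real_Domain) - int \<tau>))
   \<and> (\<forall>k b X \<rho> zS zO aTP aP cTP cP.
        k \<in> unit_residues M \<longrightarrow> b \<in> bitvecs M \<longrightarrow>
        (\<forall>i\<in>{1..n}. X i \<subseteq> {0..<q}) \<longrightarrow>
        reference_labels M k q Apos Aneg b \<rho> \<longrightarrow>
        correct_labels M k Apos n X b zS zO \<longrightarrow>
        ct_shares p M zS zO \<rho> (selector M k q Apos Aneg) aTP aP cTP cP \<longrightarrow>
        (ct_flag p \<tau> (region_size q Apos Aneg) aTP aP cTP cP = 1 \<longleftrightarrow> card (\<Inter>i\<in>{1..n}. X i) \<ge> \<tau>))"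
proof (intro conjI allI impI)
  \<comment> \<open>A region lies inside the universe, so its size is at most \<open>M\<close>,
    hence below \<open>p\<close>.\<close>
  have size: "int (region_size q Apos Aneg R) < p" for R
    using region_size_le[OF assms(2), of R] assms(4) by linarith
  {
    fix zS zO \<rho> m aTP aP cTP cP
    assume "zS \<in> bitvecs M" "zO \<in> bitvecs M" "\<rho> \<in> bitvecs M"
      "\<forall>R. selects M (m R) (region_size q Apos Aneg R)"
      "ct_shares p M zS zO \<rho> m aTP aP cTP cP"
    then show "ct_flag p \<tau> (region_size q Apos Aneg) aTP aP cTP cP = 1 \<longleftrightarrow>
           deficit M (region_size q Apos Aneg Anchors) (m Anchors) \<rho> zS zO = 0 \<and>
           deficit M (region_size q Apos Aneg Real_Domain) (m Real_Domain) \<rho> zS zO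
             \<le> int (region_size q Apos Aneg Real_Domain) - int \<tau>"
      using size by (intro ct_flag_iff_deficit) auto
  }
  fix k b X \<rho> zS zO aTP aP cTP cP
  assume k: "k \<in> unit_residues M" and b: "b \<in> bitvecs M" and X: "\<forall>i\<in>{1..n}. X i \<subseteq> {0..<q}"
    and ref: "reference_labels M k q Apos Aneg b \<rho>"
    and cor: "correct_labels M k Apos n X b zS zO"
    and sh: "ct_shares p M zS zO \<rho> (selector M k q Apos Aneg) aTP aP cTP cP"
  have k': "coprime k M" and M: "M > 0"
    using k by (auto simp: unit_residues_def)
  have bits: "\<rho> \<in> bitvecs M" "zS \<in> bitvecs M" "zO \<in> bitvecs M"
    using ref cor by (auto simp: reference_labels_def correct_labels_def)
  have sel: "selects M (selector M k q Apos Aneg R) (region_size q Apos Aneg R)" for R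
    using selects_indicator[OF scaled_set_subset[OF M]]
      card_scaled_set[OF k' region_set_subset[OF assms(2)]]
    by (metis region_size_def selector_eq)
  note deficit = honest_deficit[OF assms(1,2) k b bspec[OF X] ref cor]
  \<comment> \<open>\<open>n \<ge> 1\<close> makes the index set nonempty; an empty intersection
    would be the whole type.\<close>
  have "(\<Inter>i\<in>{1..n}. X i) \<subseteq> {0..<q}"
    using X assms(1) by fastforce
  then have "{0..<q} \<inter> (Apos \<union> Aneg \<union> (\<Inter>i\<in>{1..n}. X i)) = (\<Inter>i\<in>{1..n}. X i)"
    using assms(2) unfolding augmented_universe_def by blast
  then have real: "deficit M (region_size q Apos Aneg Real_Domain)
      (selector M k q Apos Aneg Real_Domain) \<rho> zS zO
      = int (region_size q Apos Aneg Real_Domain) - int (card (\<Inter>i\<in>{1..n}. X i))"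
    using deficit[of Real_Domain] by simp
  have "(Apos \<union> Aneg) \<inter> (Apos \<union> Aneg \<union> (\<Inter>i\<in>{1..n}. X i)) = Apos \<union> Aneg"
    by blast
  then have anchors: "deficit M (region_size q Apos Aneg Anchors)
      (selector M k q Apos Aneg Anchors) \<rho> zS zO = 0"
    using deficit[of Anchors] by (simp add: region_size_def)
  \<comment> \<open>The anchor test always passes, and cancelling the size of the real domain turns
    the other into \<open>\<tau> \<le> card (\<Inter>i\<in>{1..n}. X i)\<close>. The subtraction is
    on \<open>int\<close>, so this also holds when \<open>\<tau>\<close> exceeds
    \<open>q\<close>.\<close>
  show "ct_flag p \<tau> (region_size q Apos Aneg) aTP aP cTP cP = 1 \<longleftrightarrow>
      card (\<Inter>i\<in>{1..n}. X i) \<ge> \<tau>"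
    using ct_flag_iff_deficit[where sz = "region_size q Apos Aneg" and \<tau> = \<tau>,
        OF sel bits sh size] real anchors
    by simp
qed

end
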